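(* Let $\{X_{ij}; i,j\ge 1\}$ be an infinite array of iid real-valued random variables on a probability space with probability measure $P$, having a common general distribution function $F$. Let $X$ be a random variable with distribution function $F$, let $S(x)\equiv P(X\ge x)$ for $x\in\mathbb{R}$, and let $\gamma\equiv -E\log[S(X)]$. For $k,n\ge1$ let $p_{k,n}$ be the probability that the first vector $X_1^k$ is a (strong) maximum with respect to $X_1^k,\ldots,X_n^k$, where $X_i^k\equiv(X_{i1},\ldots,X_{ik})$. Let $k_1,k_2,\ldots$ be a sequence of positive integers. (a') If $\liminf_{n\to\infty}\frac{k_n}{\log(n)}>\gamma^{-1}$, then $\lim_{n\to\infty}p_{k_n,n}=1$. (b') If $\limsup_{n\to\infty}\frac{k_n}{\log(n)}<\gamma^{-1}$, then $\lim_{n\to\infty}p_{k_n,n}=0$.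
   Context: For $a,b\in\mathbb{R}^k$ write $a\preceq b$ iff $a_i\le b_i$ for all $1\le i\le k$ (product order). Given vectors $x_1,\ldots,x_n\in\mathbb{R}^k$, $x_i$ is a (strong) maximum with respect to $x_1,\ldots,x_n$ iff there is no $j\ne i$ with $x_i\preceq x_j$. Thus $p_{k,n}=P\left(\bigcap_{j=2}^n\{X_1^k\not\preceq X_j^k\}\right)$. $\gamma^{-1}$ denotes the reciprocal $1/\gamma$. *)

theory Defs
  imports "HOL-Probability.Probability"
begin

text \<open>
  A vector in \<open>\<real>\<^sup>k\<close> is represented by a function \<open>nat \<Rightarrow> real\<close> of which only the coordinates
  \<open>1, \<dots>, k\<close> matter, since the dimension varies with the number of vectors below.
\<close>

definition prod_le :: "nat \<Rightarrow> (nat \<Rightarrow> real) \<Rightarrow> (nat \<Rightarrow> real) \<Rightarrow> bool" where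
  "prod_le k a b \<longleftrightarrow> (\<forall>i\<in>{1..k}. a i \<le> b i)"

definition strong_maximum :: "nat \<Rightarrow> nat \<Rightarrow> (nat \<Rightarrow> nat \<Rightarrow> real) \<Rightarrow> nat \<Rightarrow> bool" where
  "strong_maximum k n x i \<longleftrightarrow> \<not> (\<exists>j\<in>{1..n}. j \<noteq> i \<and> prod_le k (x i) (x j))"

definition max_prob :: "'a measure \<Rightarrow> (nat \<Rightarrow> nat \<Rightarrow> 'a \<Rightarrow> real) \<Rightarrow> nat \<Rightarrow> nat \<Rightarrow> real" where
  "max_prob M X k n = measure M {\<omega> \<in> space M. strong_maximum k n (\<lambda>i j. X i j \<omega>) 1}"

text \<open>
  The survival function has a weak inequality, so it differs from \<open>1 - F\<close> at the atoms of \<open>F\<close>.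
\<close>

definition survival :: "'a measure \<Rightarrow> ('a \<Rightarrow> real) \<Rightarrow> real \<Rightarrow> real" where
  "survival M Y x = measure M {\<omega> \<in> space M. Y \<omega> \<ge> x}"

text \<open>
  For a random variable \<open>Y\<close> on a probability space, \<open>P(survival(Y) \<le> u) \<le> u\<close> for \<open>0 \<le> u \<le> 1\<close>.
  Hence \<open>survival(Y) > 0\<close> almost surely, so the value of \<open>ln 0\<close> plays no role, and
  \<open>- ln (survival(Y))\<close> is stochastically dominated by a standard exponential variable: it is
  integrable and \<open>gamma_const\<close> lies in \<open>[0, 1]\<close>. It is \<open>0\<close> precisely when \<open>Y\<close> is almost surely
  constant.
\<close>

definition gamma_const :: "'a measure \<Rightarrow> ('a \<Rightarrow> real) \<Rightarrow> real" where
  "gamma_const M Y = - (\<integral>\<omega>. ln (survival M Y (Y \<omega>)) \<partial>M)"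

text \<open>
  The reciprocal is taken in the extended reals, where \<open>inverse 0 = \<infinity>\<close>. The real-valued
  convention \<open>inverse 0 = 0\<close> would be wrong for degenerate distributions.
\<close>

definition gamma_inv :: "'a measure \<Rightarrow> ('a \<Rightarrow> real) \<Rightarrow> ereal" where
  "gamma_inv M Y = inverse (ereal (gamma_const M Y))"

end

theory Submission
  imports Defs "HOL-Real_Asymp.Real_Asymp"
begin

text \<open>
  Conditionally on the first vector, the other vectors are iid, so
  \<open>p\<^bsub>k,n\<^esub> = E[(1 - exp (- T\<^sub>k))\<^bsup>n-1\<^esup>]\<close> with \<open>T\<^sub>k = - (\<Sum>j=1..k. ln S(X\<^bsub>1j\<^esub>))\<close>, a sum of iid
  nonnegative terms of mean \<open>\<gamma>\<close>. Since \<open>P(S(X) \<le> u) \<le> u\<close>, the terms have exponential tails, hence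
  finite variance, and Chebyshev's inequality gives \<open>T\<^sub>k \<approx> k \<gamma>\<close> with high probability. So the
  probability tends to \<open>1\<close> or \<open>0\<close> according to whether \<open>n exp (- k\<^sub>n \<gamma>)\<close> tends to \<open>0\<close> or \<open>\<infinity>\<close>.
\<close>

subsection \<open>Tails of the logarithm of the survival function\<close>

lemma (in real_distribution) borel_measurable_survival [measurable]:
  "(\<lambda>x. prob {x..}) \<in> borel_measurable borel"
proof -
  have "(\<lambda>x. - prob {x..}) \<in> borel_measurable borel"
    by (intro borel_measurable_mono monoI) (auto intro!: finite_measure_mono)
  from borel_measurable_uminus[OF this] show ?thesis by simp
qed

lemma (in real_distribution) prob_survival_le:
  assumes "0 \<le> u"
  shows "prob {x. prob {x..} \<le> u} \<le> u"
proof -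
  let ?A = "{x. prob {x..} \<le> u}"
  \<comment> \<open>A nonempty compact \<open>K \<subseteq> ?A\<close> has a minimum \<open>a \<in> ?A\<close>, and \<open>K \<subseteq> {a..}\<close>. Inner regularity thus avoids
    distinguishing whether the up-set \<open>?A\<close> is a closed or an open half-line.\<close>
  have "emeasure M ?A = (SUP K \<in> {K. K \<subseteq> ?A \<and> compact K}. emeasure M K)"
    by (rule inner_regular) (use emeasure_finite in \<open>auto simp: top_unique\<close>)
  also have "\<dots> \<le> ennreal u"
  proof (rule SUP_least)
    fix K assume K: "K \<in> {K. K \<subseteq> ?A \<and> compact K}"
    show "emeasure M K \<le> ennreal u"
    proof (cases "K = {}")
      case False
      with K obtain a where a: "a \<in> K" "\<And>x. x \<in> K \<Longrightarrow> a \<le> x"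
        using compact_attains_inf[of K] by auto
      have "emeasure M K \<le> emeasure M {a..}"
        using a by (intro emeasure_mono) auto
      also have "\<dots> \<le> ennreal u"
        using K a by (auto simp: emeasure_eq_measure assms)
      finally show ?thesis .
    qed simp
  qed
  finally show ?thesis
    using assms by (simp add: emeasure_eq_measure)
qed

text \<open>Since \<open>ln 0 = 0\<close>, a point with survival value 0 has
  \<open>exp (- neg_log_survival M x) = 1\<close>. The case \<open>u = 0\<close> of
  \<open>prob_survival_le\<close> shows that such points form a null set.\<close>

lemma (in real_distribution) AE_survival_pos: "AE x in M. 0 < prob {x..}"
proof -
  have "prob {x. prob {x..} \<le> 0} = 0"
    using prob_survival_le[of 0] measure_nonneg[of M "{x. prob {x..} \<le> 0}"] by linarith
  hence "AE x in M. x \<notin> {x. prob {x..} \<le> 0}"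
    by (intro AE_not_in) (auto simp: null_sets_def emeasure_eq_measure)
  thus ?thesis by eventually_elim (auto simp: not_le)
qed

text \<open>Depends on the law \<open>D\<close> alone, so one function serves every entry of the
  array. The closed half-line keeps the atom at \<open>x\<close>, and \<open>ln 0 = 0\<close> keeps
  the value finite and nonnegative everywhere.\<close>

definition neg_log_survival :: "real measure \<Rightarrow> real \<Rightarrow> real" where
  "neg_log_survival D x = - ln (measure D {x..})"

context real_distribution
begin

lemma borel_measurable_neg_log_survival [measurable]:
  "neg_log_survival M \<in> borel_measurable borel"
  unfolding neg_log_survival_def by measurable

lemma neg_log_survival_nonneg: "0 \<le> neg_log_survival M x"
proof (cases "prob {x..} = 0")
  case False
  hence "0 < prob {x..}"
    using measure_nonneg[of M "{x..}"] by linarith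
  thus ?thesis
    by (simp add: neg_log_survival_def)
qed (simp add: neg_log_survival_def)

text \<open>Exponentiating reduces the tail to \<open>prob_survival_le\<close> with
  \<open>u = exp (-t)\<close>. Points with survival value 0 satisfy the inclusion of events because
  \<open>0 \<le> exp (-t)\<close>.\<close>

lemma prob_neg_log_survival_ge: "prob {x. t \<le> neg_log_survival M x} \<le> exp (-t)"
proof -
  have "{x. t \<le> neg_log_survival M x} \<subseteq> {x. prob {x..} \<le> exp (-t)}"
  proof safe
    fix x assume t: "t \<le> neg_log_survival M x"
    show "prob {x..} \<le> exp (-t)"
    proof (cases "prob {x..} = 0")
      case False
      hence "0 < prob {x..}"
        using measure_nonneg[of M "{x..}"] by linarith
      hence "prob {x..} = exp (- neg_log_survival M x)"
        by (simp add: neg_log_survival_def)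
      thus ?thesis using t by simp
    qed simp
  qed
  hence "prob {x. t \<le> neg_log_survival M x} \<le> prob {x. prob {x..} \<le> exp (-t)}"
    by (intro finite_measure_mono) auto
  also have "\<dots> \<le> exp (-t)" by (rule prob_survival_le) simp
  finally show ?thesis .
qed

lemma square_integrable_neg_log_survival: "integrable M (\<lambda>x. (neg_log_survival M x)\<^sup>2)"
proof (rule integrableI_nonneg)
  let ?h = "neg_log_survival M"
  show "(\<lambda>x. (?h x)\<^sup>2) \<in> borel_measurable M" by measurable
  \<comment> \<open>Summation by parts: \<open>(N + 1)\<^sup>2\<close> is the sum of the odd numbers \<open>2 * n + 1\<close> for \<open>n \<le> N\<close>.\<close>
  let ?g = "\<lambda>n x. ennreal ((2 * real n + 1) * indicator {x. real n \<le> ?h x} x)"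
  have pw: "ennreal ((?h x)\<^sup>2) \<le> (\<Sum>n. ?g n x)" for x
  proof -
    \<comment> \<open>Exactly the indicators with \<open>n \<le> N\<close> equal 1, and their
      weights add up to \<open>(N + 1)\<^sup>2\<close>, which exceeds the square of
      \<open>?h x\<close>.\<close>
    define N where "N = nat \<lfloor>?h x\<rfloor>"
    have N: "real N \<le> ?h x" "?h x < real N + 1"
      using neg_log_survival_nonneg[of x] unfolding N_def by linarith+
    have sq: "(\<Sum>n\<le>m. (2 * real n + 1)) = (real m + 1)\<^sup>2" for m
      by (induction m) (auto simp: power2_eq_square algebra_simps)
    have "(?h x)\<^sup>2 \<le> (real N + 1)\<^sup>2"
      using N neg_log_survival_nonneg[of x] by (intro power_mono) auto
    also have "\<dots> = (\<Sum>n\<le>N. (2 * real n + 1) * indicator {x. real n \<le> ?h x} x)"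
      unfolding sq[symmetric] using N by (intro sum.cong) (auto simp: indicator_def)
    finally have "ennreal ((?h x)\<^sup>2) \<le> ennreal (\<Sum>n\<le>N. (2 * real n + 1) * indicator {x. real n \<le> ?h x} x)"
      by (rule ennreal_leI)
    also have "\<dots> = (\<Sum>n\<le>N. ?g n x)"
      by (subst sum_ennreal) auto
    also have "\<dots> \<le> (\<Sum>n. ?g n x)" by (intro sum_le_suminf) auto
    finally show ?thesis .
  qed
  \<comment> \<open>As \<open>2 * n + 1 \<le> 2 * (n + 1)\<close>, the derivative of the geometric
    series at \<open>exp (-1)\<close> dominates.\<close>
  have summ: "summable (\<lambda>n. (2 * real n + 1) * exp (-real n))"
  proof (rule summable_comparison_test)
    show "summable (\<lambda>n. 2 * (real (Suc n) * exp (-1) ^ n))"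
      using geometric_deriv_sums[of "exp (-1::real)"] by (intro summable_mult) (auto simp: sums_iff)
    show "\<exists>N. \<forall>n\<ge>N. norm ((2 * real n + 1) * exp (-real n)) \<le> 2 * (real (Suc n) * exp (-1) ^ n)"
      by (auto simp: exp_of_nat_mult[symmetric] algebra_simps)
  qed
  have "(\<integral>\<^sup>+x. ennreal ((?h x)\<^sup>2) \<partial>M) \<le> (\<integral>\<^sup>+x. (\<Sum>n. ?g n x) \<partial>M)"
    by (intro nn_integral_mono pw)
  also have "\<dots> = (\<Sum>n. \<integral>\<^sup>+x. ?g n x \<partial>M)"
    by (intro nn_integral_suminf) measurable
  also have "\<dots> \<le> (\<Sum>n. ennreal ((2 * real n + 1) * exp (-real n)))"
  proof (intro suminf_le allI summableI)
    fix n
    have "(\<integral>\<^sup>+x. ?g n x \<partial>M) = ennreal (2 * real n + 1) * emeasure M {x. real n \<le> ?h x}"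
      by (simp add: ennreal_mult nn_integral_cmult ennreal_indicator)
    also have "\<dots> = ennreal ((2 * real n + 1) * prob {x. real n \<le> ?h x})"
      by (simp add: emeasure_eq_measure ennreal_mult)
    also have "\<dots> \<le> ennreal ((2 * real n + 1) * exp (-real n))"
      by (intro ennreal_leI mult_left_mono prob_neg_log_survival_ge) auto
    finally show "(\<integral>\<^sup>+x. ?g n x \<partial>M) \<le> ennreal ((2 * real n + 1) * exp (-real n))" .
  qed
  also have "\<dots> < \<infinity>"
    by (subst suminf_ennreal2[OF _ summ]) auto
  finally show "(\<integral>\<^sup>+x. ennreal ((?h x)\<^sup>2) \<partial>M) < \<infinity>" .
qed auto

end

subsection \<open>Sums of independent random variables\<close>

context prob_space
begin

text \<open>Induction on \<open>J\<close>: the new term is independent of the partial sum, so the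
  mean of their product factorises and the cross terms cancel. Square integrability of the sum is
  carried along because the next step expands the variance of that sum.\<close>

lemma variance_sum_indep:
  fixes Z :: "'i \<Rightarrow> 'a \<Rightarrow> real"
  assumes "finite J" "indep_vars (\<lambda>_. borel) Z J"
    and "\<And>j. j \<in> J \<Longrightarrow> integrable M (\<lambda>x. (Z j x)\<^sup>2)"
  shows "integrable M (\<lambda>x. (\<Sum>j\<in>J. Z j x)\<^sup>2) \<and>
    variance (\<lambda>x. \<Sum>j\<in>J. Z j x) = (\<Sum>j\<in>J. variance (Z j))"
  using assms
proof (induction J rule: finite_induct)
  case empty
  thus ?case by simp
next
  case (insert i J)
  let ?S = "\<lambda>x. \<Sum>j\<in>J. Z j x"
  have [measurable]: "random_variable borel (Z j)" if "j \<in> insert i J" for j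
    using insert.prems that by (auto simp: indep_vars_def)
  have rvS [measurable]: "random_variable borel ?S"
    by (intro borel_measurable_sum) auto
  have IH: "integrable M (\<lambda>x. (?S x)\<^sup>2)" "variance ?S = (\<Sum>j\<in>J. variance (Z j))"
    using insert.IH insert.prems indep_vars_subset[of "\<lambda>_. borel" Z "insert i J" J] by auto
  have Zi: "integrable M (\<lambda>x. (Z i x)\<^sup>2)" using insert.prems by auto
  have iS: "integrable M ?S" and iZ: "integrable M (Z i)"
    using IH Zi by (auto intro: square_integrable_imp_integrable)
  have ind: "indep_var borel (Z i) borel ?S"
    by (rule indep_vars_sum) (use insert in auto)
  have iP: "integrable M (\<lambda>x. Z i x * ?S x)"
    by (rule indep_var_integrable[OF ind iZ iS])
  have eP: "expectation (\<lambda>x. Z i x * ?S x) = expectation (Z i) * expectation ?S"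
    by (rule indep_var_lebesgue_integral[OF ind iZ iS])
  have sq: "(Z i x + ?S x)\<^sup>2 = (Z i x)\<^sup>2 + 2 * (Z i x * ?S x) + (?S x)\<^sup>2" for x
    by (simp add: power2_sum)
  have int: "integrable M (\<lambda>x. (Z i x + ?S x)\<^sup>2)"
    unfolding sq using Zi iP IH(1) by (intro Bochner_Integration.integrable_add) auto
  have "variance (\<lambda>x. Z i x + ?S x) =
      expectation (\<lambda>x. (Z i x + ?S x)\<^sup>2) - (expectation (\<lambda>x. Z i x + ?S x))\<^sup>2"
    using iZ iS int by (intro variance_eq) auto
  also have "expectation (\<lambda>x. Z i x + ?S x) = expectation (Z i) + expectation ?S"
    using iZ iS by (rule Bochner_Integration.integral_add)
  also have "expectation (\<lambda>x. (Z i x + ?S x)\<^sup>2) =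
     expectation (\<lambda>x. (Z i x)\<^sup>2) + 2 * (expectation (Z i) * expectation ?S) + expectation (\<lambda>x. (?S x)\<^sup>2)"
    unfolding sq using Zi iP IH(1)
    by (subst Bochner_Integration.integral_add | simp add: eP)+
  also have "\<dots> - (expectation (Z i) + expectation ?S)\<^sup>2 = variance (Z i) + variance ?S"
    using variance_eq[OF iZ Zi] variance_eq[OF iS IH(1)] by (simp add: power2_sum)
  finally show ?case
    using insert.hyps int by (simp add: IH(2) Bochner_Integration.integral_add[OF iZ iS])
qed

text \<open>The allowed deviation grows with \<open>card J\<close>. The variance is only linear in
  \<open>card J\<close>, so one factor \<open>card J\<close> remains in the denominator and the
  bound vanishes for long sums.\<close>

lemma Chebyshev_sum_indep:
  fixes Z :: "'i \<Rightarrow> 'a \<Rightarrow> real" and \<epsilon> :: real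
  assumes J: "finite J" "J \<noteq> {}" and ind: "indep_vars (\<lambda>_. borel) Z J"
    and sq: "\<And>j. j \<in> J \<Longrightarrow> integrable M (\<lambda>x. (Z j x)\<^sup>2)"
    and mean: "\<And>j. j \<in> J \<Longrightarrow> expectation (Z j) = \<mu>"
    and var: "\<And>j. j \<in> J \<Longrightarrow> variance (Z j) = v"
    and "0 < \<epsilon>"
  shows "prob {x \<in> space M. \<bar>(\<Sum>j\<in>J. Z j x) - real (card J) * \<mu>\<bar> \<ge> real (card J) * \<epsilon>} \<le> v / (real (card J) * \<epsilon>\<^sup>2)"
proof -
  have [measurable]: "random_variable borel (Z j)" if "j \<in> J" for j
    using ind that by (auto simp: indep_vars_def)
  have int: "integrable M (Z j)" if "j \<in> J" for j
    using that sq by (auto intro: square_integrable_imp_integrable)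
  have c: "0 < real (card J)" using J by (simp add: card_gt_0_iff)
  have e: "expectation (\<lambda>x. \<Sum>j\<in>J. Z j x) = real (card J) * \<mu>"
    using int mean by simp
  have "prob {x \<in> space M. \<bar>(\<Sum>j\<in>J. Z j x) - expectation (\<lambda>x. \<Sum>j\<in>J. Z j x)\<bar> \<ge> real (card J) * \<epsilon>}
      \<le> variance (\<lambda>x. \<Sum>j\<in>J. Z j x) / (real (card J) * \<epsilon>)\<^sup>2"
    using variance_sum_indep[OF J(1) ind sq] c \<open>0 < \<epsilon>\<close> by (intro Chebyshev_inequality) auto
  also have "variance (\<lambda>x. \<Sum>j\<in>J. Z j x) = real (card J) * v"
    using variance_sum_indep[OF J(1) ind sq] var by simp
  also have "real (card J) * v / (real (card J) * \<epsilon>)\<^sup>2 = v / (real (card J) * \<epsilon>\<^sup>2)"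
    using c by (simp add: power2_eq_square)
  finally show ?thesis unfolding e .
qed

end

subsection \<open>Conditioning on the first vector\<close>

context prob_space
begin

text \<open>Grouping the index pairs into the singletons \<open>{(i, j)}\<close> reindexes the row
  by \<open>j\<close>; evaluation at \<open>(i, j)\<close> then recovers the entry.\<close>

lemma indep_vars_row:
  assumes ind: "indep_vars (\<lambda>_. N) (\<lambda>(i, j). X i j) (I \<times> J)" and i: "i \<in> I"
  shows "indep_vars (\<lambda>_. N) (X i) J"
proof -
  have "indep_vars (\<lambda>j. PiM {(i, j)} (\<lambda>_. N)) (\<lambda>j \<omega>. restrict (\<lambda>p. (case p of (i, j) \<Rightarrow> X i j) \<omega>) {(i, j)}) J"
    by (rule indep_vars_restrict[OF ind]) (use i in \<open>auto simp: disjoint_family_on_def\<close>)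
  from indep_vars_compose2[OF this, of "\<lambda>j f. f (i, j)" "\<lambda>_. N"]
  show ?thesis by simp
qed

text \<open>The disjoint blocks \<open>{i} \<times> J\<close> give independent families indexed by
  pairs; composing with a measurable reindexing turns each family into a vector indexed by
  \<open>J\<close>.\<close>

lemma indep_vars_rows:
  assumes ind: "indep_vars (\<lambda>_. N) (\<lambda>(i, j). X i j) (I \<times> J)"
  shows "indep_vars (\<lambda>_. PiM J (\<lambda>_. N)) (\<lambda>i \<omega>. \<lambda>j\<in>J. X i j \<omega>) I"
proof -
  have "indep_vars (\<lambda>i. PiM ({i} \<times> J) (\<lambda>_. N)) (\<lambda>i \<omega>. restrict (\<lambda>p. (case p of (i, j) \<Rightarrow> X i j) \<omega>) ({i} \<times> J)) I"
    by (rule indep_vars_restrict[OF ind]) (auto simp: disjoint_family_on_def)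
  from indep_vars_compose2[OF this, of "\<lambda>i f. \<lambda>j\<in>J. f (i, j)" "\<lambda>_. PiM J (\<lambda>_. N)"]
  have "indep_vars (\<lambda>_. PiM J (\<lambda>_. N)) (\<lambda>i \<omega>. \<lambda>j\<in>J. restrict (\<lambda>p. (case p of (i, j) \<Rightarrow> X i j) \<omega>) ({i} \<times> J) (i, j)) I"
    by simp
  thus ?thesis by (simp cong: restrict_cong)
qed

end

text \<open>A box of closed half-lines has product measure equal to the product of survival values
  with weak inequality, atoms included.\<close>

lemma (in real_distribution) Collect_prod_le_eq_PiE:
  "{b \<in> space (PiM {1..k} (\<lambda>_. M)). prod_le k a b} = PiE {1..k} (\<lambda>j. {a j..})"
  unfolding prod_le_def space_PiM PiE_def Pi_def by auto

lemma (in real_distribution) prob_prod_le: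
  "measure (PiM {1..k} (\<lambda>_. M)) {b \<in> space (PiM {1..k} (\<lambda>_. M)). prod_le k a b} =
    (\<Prod>j=1..k. prob {a j..})"
proof -
  interpret P: finite_product_prob_space "\<lambda>_. M" "{1..k}" by unfold_locales simp
  show ?thesis
    unfolding Collect_prod_le_eq_PiE by (rule P.finite_measure_PiM_emb) simp
qed

section \<open>The maximum event on the product space, and its transfer to the array\<close>

lemma sets_strong_maximum:
  fixes k n i :: nat and D :: "real measure"
  assumes "sets D = sets borel" "i \<in> {1..n}"
  defines "Q \<equiv> PiM {1..k} (\<lambda>_. D)"
  shows "{x \<in> space (PiM {1..n} (\<lambda>_. Q)). strong_maximum k n x i} \<in> sets (PiM {1..n} (\<lambda>_. Q))"
proof -
  have comp: "(\<lambda>x. x i j) \<in> borel_measurable (PiM {1..n} (\<lambda>_. Q))"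
    if "i \<in> {1..n}" "j \<in> {1..k}" for i j
  proof -
    have "(\<lambda>a. a j) \<in> Q \<rightarrow>\<^sub>M D"
      using that unfolding Q_def by simp
    hence "(\<lambda>a. a j) \<in> Q \<rightarrow>\<^sub>M borel"
      by (simp cong: measurable_cong_sets add: assms(1))
    from measurable_compose[OF measurable_component_singleton[OF that(1), of "\<lambda>_. Q"] this]
    show ?thesis .
  qed
  show ?thesis
    unfolding strong_maximum_def prod_le_def
    by (intro sets.sets_Collect sets.sets_Collect_finite_Ex sets.sets_Collect_finite_All
        borel_measurable_le comp) (use assms(2) in auto)
qed

text \<open>Fubini with the first vector \<open>a\<close> as the outer variable. Given
  \<open>a\<close>, the \<open>n - 1\<close> other vectors must independently avoid the set of
  vectors above \<open>a\<close>, which yields the power.\<close>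

lemma (in real_distribution) emeasure_strong_maximum_first:
  fixes k n :: nat
  assumes n: "n \<ge> 1"
  defines "Q \<equiv> PiM {1..k} (\<lambda>_. M)"
  shows "emeasure (PiM {1..n} (\<lambda>_. Q)) {x \<in> space (PiM {1..n} (\<lambda>_. Q)). strong_maximum k n x 1} =
    (\<integral>\<^sup>+ a. ennreal ((1 - (\<Prod>j=1..k. prob {a j..})) ^ (n - 1)) \<partial>Q)"
proof -
  interpret QQ: product_prob_space "\<lambda>_. M" "{1..k}" by unfold_locales
  interpret Q: prob_space Q unfolding Q_def by unfold_locales
  interpret P: product_prob_space "\<lambda>_::nat. Q" "{2..n}" by unfold_locales
  let ?T = "{x \<in> space (PiM {1..n} (\<lambda>_. Q)). strong_maximum k n x 1}"
  have ins: "{1..n} = insert 1 {2..n}" using n by auto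
  have T: "?T \<in> sets (PiM {1..n} (\<lambda>_. Q))"
    unfolding Q_def by (rule sets_strong_maximum) (use n in auto)
  have "emeasure (PiM {1..n} (\<lambda>_. Q)) ?T = (\<integral>\<^sup>+ x. indicator ?T x \<partial>PiM {1..n} (\<lambda>_. Q))"
    using T by simp
  also have "\<dots> = (\<integral>\<^sup>+ a. (\<integral>\<^sup>+ x. indicator ?T (x(1 := a)) \<partial>PiM {2..n} (\<lambda>_. Q)) \<partial>Q)"
    unfolding ins using T ins by (subst P.product_nn_integral_insert_rev) auto
  also have "\<dots> = (\<integral>\<^sup>+ a. ennreal ((1 - (\<Prod>j=1..k. prob {a j..})) ^ (n - 1)) \<partial>Q)"
  proof (rule nn_integral_cong)
    fix a assume a: "a \<in> space Q"
    let ?B = "{b \<in> space Q. prod_le k a b}"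
    have B: "?B \<in> sets Q"
      unfolding Q_def Collect_prod_le_eq_PiE by (intro sets_PiM_I_finite) auto
    \<comment> \<open>With the first row fixed at \<open>a\<close>, the event becomes a box over the
      rows \<open>2\<close> to \<open>n\<close>, each side being the complement of
      \<open>?B\<close>. Its measure factorises.\<close>
    have "(\<integral>\<^sup>+ x. indicator ?T (x(1 := a)) \<partial>PiM {2..n} (\<lambda>_. Q)) =
        (\<integral>\<^sup>+ x. indicator (PiE {2..n} (\<lambda>_. space Q - ?B)) x \<partial>PiM {2..n} (\<lambda>_. Q))"
    proof (rule nn_integral_cong)
      fix x assume x: "x \<in> space (PiM {2..n} (\<lambda>_. Q))"
      have "x(1 := a) \<in> space (PiM {1..n} (\<lambda>_. Q))"
        using x a unfolding ins by (auto simp: space_PiM PiE_iff extensional_def)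
      moreover have "strong_maximum k n (x(1 := a)) 1 \<longleftrightarrow> (\<forall>j\<in>{2..n}. \<not> prod_le k a (x j))"
        by (auto simp: strong_maximum_def ins)
      ultimately show "indicator ?T (x(1 := a)) = (indicator (PiE {2..n} (\<lambda>_. space Q - ?B)) x :: ennreal)"
        using x by (auto simp: indicator_def space_PiM PiE_iff)
    qed
    also have "\<dots> = emeasure (PiM {2..n} (\<lambda>_. Q)) (PiE {2..n} (\<lambda>_. space Q - ?B))"
      using B by (intro nn_integral_indicator sets_PiM_I_finite) auto
    also have "\<dots> = (\<Prod>j\<in>{2..n}. emeasure Q (space Q - ?B))"
      using B by (intro P.emeasure_PiM) auto
    also have "\<dots> = ennreal ((1 - Q.prob ?B) ^ (n - 1))"
      using B by (simp add: Q.emeasure_eq_measure Q.prob_compl ennreal_power)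
    finally show "(\<integral>\<^sup>+ x. indicator ?T (x(1 := a)) \<partial>PiM {2..n} (\<lambda>_. Q)) =
        ennreal ((1 - (\<Prod>j=1..k. prob {a j..})) ^ (n - 1))"
      unfolding Q_def prob_prod_le .
  qed
  finally show ?thesis .
qed

text \<open>Independence makes the joint law of the first \<open>n\<close> rows a product of copies
  of \<open>Q\<close>, so the event can be measured on the product space.\<close>

lemma (in prob_space) max_prob_eq:
  fixes X :: "nat \<Rightarrow> nat \<Rightarrow> 'a \<Rightarrow> real"
  assumes ind: "indep_vars (\<lambda>_. borel) (\<lambda>(i, j). X i j) ({1..} \<times> {1..})"
    and D: "\<And>i j. i \<ge> 1 \<Longrightarrow> j \<ge> 1 \<Longrightarrow> distr M borel (X i j) = D"
    and k: "k \<ge> 1" and n: "n \<ge> 1"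
  shows "max_prob M X k n = expectation (\<lambda>\<omega>. (1 - (\<Prod>j=1..k. measure D {X 1 j \<omega>..})) ^ (n - 1))"
proof -
  have rv [measurable]: "random_variable borel (X i j)" if "i \<ge> 1" "j \<ge> 1" for i j
    using ind that by (auto simp: indep_vars_def)
  interpret D: real_distribution D
    using D[of 1 1] rv[of 1 1] by (auto intro!: real_distribution_distr)
  have ind': "indep_vars (\<lambda>_. borel) (\<lambda>(i, j). X i j) ({1..n} \<times> {1..k})"
    by (rule indep_vars_subset[OF ind]) auto
  define row where "row = (\<lambda>i \<omega>. \<lambda>j\<in>{1..k}. X i j \<omega>)"
  \<comment> \<open>\<open>B\<close> supplies only measurable sets, as target space of the rows;
    \<open>Q\<close> is the law of a row and has the same measurable sets.\<close>
  define B :: "(nat \<Rightarrow> real) measure" where "B = PiM {1..k} (\<lambda>_. borel)"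
  define Q where "Q = PiM {1..k} (\<lambda>_. D)"
  have setsQ: "sets Q = sets B"
    unfolding Q_def B_def by (intro sets_PiM_cong) auto
  have rvrow: "random_variable B (row i)" if "i \<in> {1..n}" for i
    using that unfolding row_def B_def by (auto intro!: measurable_restrict)
  have distr_row: "distr M B (row i) = Q" if i: "i \<in> {1..n}" for i
  proof -
    have "distr M B (row i) = PiM {1..k} (\<lambda>j. distr M borel (X i j))"
      unfolding row_def B_def
      by (subst indep_vars_iff_distr_eq_PiM'[symmetric])
        (use i k indep_vars_row[OF ind' i] in \<open>auto intro!: rv\<close>)
    also have "\<dots> = Q"
      unfolding Q_def using i by (intro PiM_cong) (auto simp: D)
    finally show ?thesis .
  qed
  have "indep_vars (\<lambda>_. B) row {1..n}"
    unfolding B_def row_def by (rule indep_vars_rows[OF ind'])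
  hence distr_rows: "distr M (PiM {1..n} (\<lambda>_. B)) (\<lambda>\<omega>. \<lambda>i\<in>{1..n}. row i \<omega>) = PiM {1..n} (\<lambda>_. Q)"
    using n rvrow by (subst (asm) indep_vars_iff_distr_eq_PiM') (auto simp: distr_row intro!: PiM_cong)
  let ?T = "{x \<in> space (PiM {1..n} (\<lambda>_. Q)). strong_maximum k n x 1}"
  let ?g = "\<lambda>a. (1 - (\<Prod>j=1..k. measure D {a j..})) ^ (n - 1)"
  have rows_meas: "(\<lambda>\<omega>. \<lambda>i\<in>{1..n}. row i \<omega>) \<in> M \<rightarrow>\<^sub>M PiM {1..n} (\<lambda>_. B)"
    using rvrow by (intro measurable_restrict) auto
  have sp: "(\<lambda>i\<in>{1..n}. row i \<omega>) \<in> space (PiM {1..n} (\<lambda>_. Q))" if "\<omega> \<in> space M" for \<omega>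
    using measurable_space[OF rows_meas that] setsQ by (simp add: space_PiM sets_eq_imp_space_eq[OF setsQ])
  \<comment> \<open>Truncating the array to \<open>n\<close> rows and \<open>k\<close> columns
    leaves the event unchanged, since only these entries are compared; \<open>n \<ge> 1\<close>
    keeps row 1 inside the range.\<close>
  have "strong_maximum k n (\<lambda>i\<in>{1..n}. row i \<omega>) 1 \<longleftrightarrow> strong_maximum k n (\<lambda>i j. X i j \<omega>) 1" for \<omega>
    using n by (auto simp: strong_maximum_def prod_le_def row_def)
  hence ev: "{\<omega> \<in> space M. strong_maximum k n (\<lambda>i j. X i j \<omega>) 1} =
      (\<lambda>\<omega>. \<lambda>i\<in>{1..n}. row i \<omega>) -` ?T \<inter> space M"
    using sp by auto
  have prod_le1: "(\<Prod>j=1..k. measure D {a j..}) \<le> 1" for a :: "nat \<Rightarrow> real"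
    by (auto intro!: prod_le_1)
  have gB: "?g \<in> borel_measurable B"
  proof -
    have [measurable]: "(\<lambda>a. a j) \<in> B \<rightarrow>\<^sub>M borel" if "j \<in> {1..k}" for j
      using that unfolding B_def by (rule measurable_component_singleton)
    have "(\<lambda>a. measure D {a j..}) \<in> borel_measurable B" if "j \<in> {1..k}" for j
      using that by (intro measurable_compose[OF _ D.borel_measurable_survival]) auto
    thus ?thesis by (intro borel_measurable_power borel_measurable_diff borel_measurable_prod) auto
  qed
  have T: "?T \<in> sets (PiM {1..n} (\<lambda>_. B))"
  proof -
    have "sets (PiM {1..n} (\<lambda>_. Q)) = sets (PiM {1..n} (\<lambda>_. B))"
      by (intro sets_PiM_cong setsQ refl)
    moreover have "?T \<in> sets (PiM {1..n} (\<lambda>_. Q))"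
      unfolding Q_def by (rule sets_strong_maximum) (use n in auto)
    ultimately show ?thesis by simp
  qed
  have "emeasure M {\<omega> \<in> space M. strong_maximum k n (\<lambda>i j. X i j \<omega>) 1} =
      emeasure (distr M (PiM {1..n} (\<lambda>_. B)) (\<lambda>\<omega>. \<lambda>i\<in>{1..n}. row i \<omega>)) ?T"
    unfolding ev by (rule emeasure_distr[OF rows_meas T, symmetric])
  also have "\<dots> = (\<integral>\<^sup>+ a. ennreal (?g a) \<partial>Q)"
    unfolding distr_rows unfolding Q_def by (rule D.emeasure_strong_maximum_first[OF n])
  \<comment> \<open>Reading \<open>Q\<close> as the law of the first row brings the integral back to
    the original space.\<close>
  also have "\<dots> = (\<integral>\<^sup>+ a. ennreal (?g a) \<partial>distr M B (row 1))"
    using distr_row[of 1] n by simp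
  also have "\<dots> = (\<integral>\<^sup>+ \<omega>. ennreal (?g (row 1 \<omega>)) \<partial>M)"
    using rvrow[of 1] n gB by (intro nn_integral_distr) auto
  also have "\<dots> = (\<integral>\<^sup>+ \<omega>. ennreal ((1 - (\<Prod>j=1..k. measure D {X 1 j \<omega>..})) ^ (n - 1)) \<partial>M)"
    by (simp add: row_def)
  finally have "emeasure M {\<omega> \<in> space M. strong_maximum k n (\<lambda>i j. X i j \<omega>) 1} =
      (\<integral>\<^sup>+ \<omega>. ennreal ((1 - (\<Prod>j=1..k. measure D {X 1 j \<omega>..})) ^ (n - 1)) \<partial>M)" .
  moreover have "(\<lambda>\<omega>. \<Prod>j=1..k. measure D {X 1 j \<omega>..}) \<in> borel_measurable M"
    by (intro borel_measurable_prod measurable_compose[OF _ D.borel_measurable_survival]) auto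
  moreover have "0 \<le> (1 - (\<Prod>j=1..k. measure D {X 1 j \<omega>..})) ^ (n - 1)" for \<omega>
    using prod_le1[of "\<lambda>j. X 1 j \<omega>"] by simp
  ultimately show ?thesis
    unfolding max_prob_def measure_def by (subst integral_eq_nn_integral) auto
qed

subsection \<open>Concentration and limits\<close>

text \<open>Fixes one law \<open>D\<close> for all entries; the final theorem instantiates it with
  the law of \<open>Y\<close>.\<close>

locale iid_array = prob_space M for M :: "'a measure" +
  fixes X :: "nat \<Rightarrow> nat \<Rightarrow> 'a \<Rightarrow> real" and D :: "real measure"
  assumes indep: "indep_vars (\<lambda>_. borel) (\<lambda>(i, j). X i j) ({1..} \<times> {1..})"
    and distr_X: "\<And>i j. i \<ge> 1 \<Longrightarrow> j \<ge> 1 \<Longrightarrow> distr M borel (X i j) = D"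
begin

lemma X_measurable [measurable]: "i \<ge> 1 \<Longrightarrow> j \<ge> 1 \<Longrightarrow> random_variable borel (X i j)"
  using indep by (auto simp: indep_vars_def)

sublocale D: real_distribution D
  using distr_X[of 1 1] real_distribution_distr[OF X_measurable[of 1 1]] by simp

definition neg_log_sum :: "nat \<Rightarrow> 'a \<Rightarrow> real" where
  "neg_log_sum m \<omega> = (\<Sum>j=1..m. neg_log_survival D (X 1 j \<omega>))"

definition \<gamma> :: real where "\<gamma> = D.expectation (neg_log_survival D)"

definition v :: real where "v = D.variance (neg_log_survival D)"

lemma \<gamma>_nonneg: "0 \<le> \<gamma>"
  unfolding \<gamma>_def by (intro integral_nonneg_AE AE_I2 D.neg_log_survival_nonneg)

lemma neg_log_sum_measurable [measurable]: "random_variable borel (neg_log_sum m)"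
  unfolding neg_log_sum_def
  by (intro borel_measurable_sum measurable_compose[OF _ D.borel_measurable_neg_log_survival]) auto

text \<open>The terms are nonnegative. This lets an upper bound on a longer sum control a shorter
  one.\<close>

lemma neg_log_sum_mono: "k \<le> m \<Longrightarrow> neg_log_sum k \<omega> \<le> neg_log_sum m \<omega>"
  unfolding neg_log_sum_def by (intro sum_mono2) (auto simp: D.neg_log_survival_nonneg)

lemma integral_X:
  fixes g :: "real \<Rightarrow> real"
  assumes "i \<ge> 1" "j \<ge> 1" "g \<in> borel_measurable borel"
  shows "expectation (\<lambda>\<omega>. g (X i j \<omega>)) = D.expectation g"
  using assms by (subst distr_X[OF assms(1,2), symmetric]) (simp add: integral_distr)

lemma neg_log_sum_deviation:
  assumes "m \<ge> 1" "\<epsilon> > 0"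
  shows "prob {\<omega> \<in> space M. \<bar>neg_log_sum m \<omega> - m * \<gamma>\<bar> \<ge> m * \<epsilon>} \<le> v / (m * \<epsilon>\<^sup>2)"
proof -
  let ?h = "neg_log_survival D"
  have "indep_vars (\<lambda>_. borel) (X 1) {1..m}"
    by (rule indep_vars_subset[OF indep_vars_row[OF indep]]) auto
  hence "indep_vars (\<lambda>_. borel) (\<lambda>j \<omega>. ?h (X 1 j \<omega>)) {1..m}"
    by (rule indep_vars_compose2) auto
  moreover have "integrable M (\<lambda>\<omega>. (?h (X 1 j \<omega>))\<^sup>2)" if "j \<in> {1..m}" for j
  proof -
    have "integrable (distr M borel (X 1 j)) (\<lambda>x. (?h x)\<^sup>2)"
      using that D.square_integrable_neg_log_survival by (simp add: distr_X)
    thus ?thesis using that by (subst (asm) integrable_distr_eq) auto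
  qed
  moreover have "expectation (\<lambda>\<omega>. ?h (X 1 j \<omega>)) = \<gamma>" if "j \<in> {1..m}" for j
    using that unfolding \<gamma>_def by (intro integral_X) auto
  moreover have "expectation (\<lambda>\<omega>. (?h (X 1 j \<omega>) - \<gamma>)\<^sup>2) = v" if "j \<in> {1..m}" for j
    using that unfolding v_def \<gamma>_def[symmetric] by (intro integral_X) auto
  ultimately show ?thesis
    using Chebyshev_sum_indep[of "{1..m}" "\<lambda>j \<omega>. ?h (X 1 j \<omega>)" \<gamma> v \<epsilon>] assms
    unfolding neg_log_sum_def by simp
qed

text \<open>The product of survival values equals \<open>exp (- neg_log_sum k \<omega>)\<close> only
  where all factors are positive, because \<open>ln 0 = 0\<close>. This holds almost surely, which
  suffices under the expectation.\<close>

lemma max_prob_eq_exp: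
  assumes "k \<ge> 1" "n \<ge> 1"
  shows "max_prob M X k n = expectation (\<lambda>\<omega>. (1 - exp (- neg_log_sum k \<omega>)) ^ (n - 1))"
proof -
  have "AE \<omega> in M. \<forall>j\<in>{1..k}. 0 < measure D {X 1 j \<omega>..}"
  proof (rule AE_finite_allI)
    fix j assume j: "j \<in> {1..k}"
    hence j': "j \<ge> 1" by simp
    have "AE x in distr M borel (X 1 j). 0 < measure D {x..}"
      unfolding distr_X[OF order_refl j'] by (rule D.AE_survival_pos)
    thus "AE \<omega> in M. 0 < measure D {X 1 j \<omega>..}"
      using j by (subst (asm) AE_distr_iff) auto
  qed simp
  hence "AE \<omega> in M. (\<Prod>j=1..k. measure D {X 1 j \<omega>..}) = exp (- neg_log_sum k \<omega>)"
  proof eventually_elim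
    case (elim \<omega>)
    have "exp (- neg_log_sum k \<omega>) = (\<Prod>j=1..k. exp (ln (measure D {X 1 j \<omega>..})))"
      by (simp add: neg_log_sum_def neg_log_survival_def sum_negf exp_sum)
    also have "\<dots> = (\<Prod>j=1..k. measure D {X 1 j \<omega>..})"
      using elim by (intro prod.cong) auto
    finally show ?case ..
  qed
  moreover have "(\<lambda>\<omega>. \<Prod>j=1..k. measure D {X 1 j \<omega>..}) \<in> borel_measurable M"
    by (intro borel_measurable_prod measurable_compose[OF _ D.borel_measurable_survival]) auto
  ultimately have "expectation (\<lambda>\<omega>. (1 - (\<Prod>j=1..k. measure D {X 1 j \<omega>..})) ^ (n - 1)) =
      expectation (\<lambda>\<omega>. (1 - exp (- neg_log_sum k \<omega>)) ^ (n - 1))"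
    by (intro integral_cong_AE) auto
  moreover have "max_prob M X k n = expectation (\<lambda>\<omega>. (1 - (\<Prod>j=1..k. measure D {X 1 j \<omega>..})) ^ (n - 1))"
    by (rule max_prob_eq) (use indep distr_X assms in auto)
  ultimately show ?thesis by simp
qed

section \<open>Two-sided bounds for fixed \<open>k\<close> and \<open>n\<close>\<close>

lemma integrable_max_integrand: "integrable M (\<lambda>\<omega>. (1 - exp (- neg_log_sum k \<omega>)) ^ (n - 1))"
proof (rule integrable_const_bound[of _ 1])
  have "0 \<le> neg_log_sum k \<omega>" for \<omega>
    unfolding neg_log_sum_def by (intro sum_nonneg D.neg_log_survival_nonneg)
  thus "AE \<omega> in M. norm ((1 - exp (- neg_log_sum k \<omega>)) ^ (n - 1)) \<le> 1"
    by (auto simp: power_abs intro!: AE_I2 power_le_one)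
qed measurable

text \<open>Off the deviation event \<open>?B\<close>, the sum is at least
  \<open>k * (\<gamma> - \<epsilon>)\<close> and Bernoulli's inequality bounds the power from below.
  On \<open>?B\<close>, subtracting the indicator makes the lower bound nonpositive.\<close>

lemma max_prob_ge:
  fixes k n :: nat and \<epsilon> :: real
  assumes "k \<ge> 1" "n \<ge> 1" "\<epsilon> > 0"
  shows "1 - n * exp (- (k * (\<gamma> - \<epsilon>))) - v / (k * \<epsilon>\<^sup>2) \<le> max_prob M X k n"
proof -
  let ?B = "{\<omega> \<in> space M. \<bar>neg_log_sum k \<omega> - k * \<gamma>\<bar> \<ge> k * \<epsilon>}"
  let ?c = "1 - n * exp (- (k * (\<gamma> - \<epsilon>)))"
  have "?c - v / (k * \<epsilon>\<^sup>2) \<le> ?c - prob ?B"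
    using neg_log_sum_deviation[of k \<epsilon>] assms by simp
  also have "\<dots> = expectation (\<lambda>\<omega>. ?c - indicator ?B \<omega>)"
    by (subst Bochner_Integration.integral_diff) (auto simp: prob_space emeasure_eq_measure)
  also have "\<dots> \<le> expectation (\<lambda>\<omega>. (1 - exp (- neg_log_sum k \<omega>)) ^ (n - 1))"
  proof (intro integral_mono integrable_max_integrand)
    fix \<omega> assume w: "\<omega> \<in> space M"
    have nn: "0 \<le> neg_log_sum k \<omega>"
      unfolding neg_log_sum_def by (intro sum_nonneg D.neg_log_survival_nonneg)
    show "?c - indicator ?B \<omega> \<le> (1 - exp (- neg_log_sum k \<omega>)) ^ (n - 1)"
    proof (cases "\<omega> \<in> ?B")
      case True
      have "?c - indicator ?B \<omega> \<le> 0" using True by simp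
      also have "0 \<le> (1 - exp (- neg_log_sum k \<omega>)) ^ (n - 1)"
        using nn by simp
      finally show ?thesis .
    next
      case False
      hence "k * (\<gamma> - \<epsilon>) \<le> neg_log_sum k \<omega>"
        using w by (auto simp: algebra_simps abs_if split: if_splits)
      hence "real (n - 1) * exp (- neg_log_sum k \<omega>) \<le> n * exp (- (k * (\<gamma> - \<epsilon>)))"
        by (intro mult_mono) auto
      hence "?c \<le> 1 + real (n - 1) * (- exp (- neg_log_sum k \<omega>))" by simp
      also have "\<dots> \<le> (1 + (- exp (- neg_log_sum k \<omega>))) ^ (n - 1)"
        using nn by (intro Bernoulli_inequality) auto
      finally show ?thesis using False by simp
    qed
  qed (auto intro!: Bochner_Integration.integrable_diff integrable_real_indicator simp: emeasure_eq_measure)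
  finally show ?thesis using assms by (simp add: max_prob_eq_exp)
qed

text \<open>Off \<open>?B\<close>, the sum of \<open>k\<close> terms is at most that of
  \<open>m\<close> terms, hence at most \<open>m * (\<gamma> + \<epsilon>)\<close>, and
  \<open>1 - q \<le> exp (- q)\<close> bounds the power. On \<open>?B\<close> the integrand is at
  most 1. The Chebyshev error depends on \<open>m\<close>, which may be chosen larger than
  \<open>k\<close>.\<close>

lemma max_prob_le:
  fixes k m n :: nat and \<epsilon> :: real
  assumes "k \<ge> 1" "k \<le> m" "n \<ge> 1" "\<epsilon> > 0"
  shows "max_prob M X k n \<le> exp (- (real (n - 1) * exp (- (m * (\<gamma> + \<epsilon>))))) + v / (m * \<epsilon>\<^sup>2)"
proof -
  let ?B = "{\<omega> \<in> space M. \<bar>neg_log_sum m \<omega> - m * \<gamma>\<bar> \<ge> m * \<epsilon>}"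
  let ?c = "exp (- (real (n - 1) * exp (- (m * (\<gamma> + \<epsilon>)))))"
  have "max_prob M X k n = expectation (\<lambda>\<omega>. (1 - exp (- neg_log_sum k \<omega>)) ^ (n - 1))"
    using assms by (simp add: max_prob_eq_exp)
  also have "\<dots> \<le> expectation (\<lambda>\<omega>. ?c + indicator ?B \<omega>)"
  proof (intro integral_mono integrable_max_integrand)
    fix \<omega> assume w: "\<omega> \<in> space M"
    have nn: "0 \<le> neg_log_sum k \<omega>"
      unfolding neg_log_sum_def by (intro sum_nonneg D.neg_log_survival_nonneg)
    show "(1 - exp (- neg_log_sum k \<omega>)) ^ (n - 1) \<le> ?c + indicator ?B \<omega>"
    proof (cases "\<omega> \<in> ?B")
      case True
      have "(1 - exp (- neg_log_sum k \<omega>)) ^ (n - 1) \<le> 1"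
        using nn by (intro power_le_one) auto
      also have "1 \<le> ?c + indicator ?B \<omega>" using True by simp
      finally show ?thesis .
    next
      case False
      hence "neg_log_sum m \<omega> \<le> m * (\<gamma> + \<epsilon>)"
        using w by (auto simp: algebra_simps abs_if split: if_splits)
      with neg_log_sum_mono[OF assms(2), of \<omega>]
      have q: "exp (- (m * (\<gamma> + \<epsilon>))) \<le> exp (- neg_log_sum k \<omega>)" by simp
      have "(1 - exp (- neg_log_sum k \<omega>)) ^ (n - 1) \<le> exp (- exp (- neg_log_sum k \<omega>)) ^ (n - 1)"
        using nn exp_ge_add_one_self[of "- exp (- neg_log_sum k \<omega>)"] by (intro power_mono) auto
      also have "\<dots> = exp (- (real (n - 1) * exp (- neg_log_sum k \<omega>)))"
        by (simp add: exp_of_nat_mult[symmetric])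
      also have "\<dots> \<le> ?c" using q by (simp add: mult_left_mono)
      finally show ?thesis using False by simp
    qed
  qed (auto intro!: Bochner_Integration.integrable_add integrable_real_indicator simp: emeasure_eq_measure)
  also have "\<dots> = ?c + prob ?B"
    by (subst Bochner_Integration.integral_add) (auto simp: prob_space emeasure_eq_measure)
  also have "\<dots> \<le> ?c + v / (m * \<epsilon>\<^sup>2)"
    using neg_log_sum_deviation[of m \<epsilon>] assms by simp
  finally show ?thesis .
qed

lemma max_prob_tendsto_1:
  fixes k :: "nat \<Rightarrow> nat"
  assumes k: "\<And>n. n \<ge> 1 \<Longrightarrow> k n \<ge> 1"
    and c: "c > 0" "c * \<gamma> > 1" "eventually (\<lambda>n. c * ln n \<le> k n) sequentially"
  shows "(\<lambda>n. max_prob M X (k n) n) \<longlonglongrightarrow> 1"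
proof -
  \<comment> \<open>Half the gap between \<open>\<gamma>\<close> and \<open>1 / c\<close>, so that
    \<open>c * (\<gamma> - \<epsilon>)\<close> is the midpoint of \<open>c * \<gamma>\<close> and 1,
    still above 1.\<close>
  define \<epsilon> where "\<epsilon> = (\<gamma> - 1 / c) / 2"
  have \<epsilon>: "\<epsilon> > 0" "c * (\<gamma> - \<epsilon>) > 1" "\<gamma> - \<epsilon> > 0"
  proof -
    have "1 / c < \<gamma>" using c by (simp add: field_simps)
    thus "\<epsilon> > 0" by (simp add: \<epsilon>_def)
    show "c * (\<gamma> - \<epsilon>) > 1" using c by (simp add: \<epsilon>_def field_simps)
    thus "\<gamma> - \<epsilon> > 0" using c by (smt (verit) mult_nonneg_nonpos)
  qed
  define b where "b = c * (\<gamma> - \<epsilon>)"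
  have k_top: "filterlim (\<lambda>n. real (k n)) at_top sequentially"
    by (rule filterlim_at_top_mono[OF _ c(3)]) (use c(1) in real_asymp)
  \<comment> \<open>For positive \<open>n\<close> the exponential is \<open>n\<close> to the power
    \<open>1 - b\<close>, which vanishes in the limit since \<open>b > 1\<close>.\<close>
  have "(\<lambda>n. 1 - exp ((1 - b) * ln (real n)) - v / (k n * \<epsilon>\<^sup>2)) \<longlonglongrightarrow> 1 - 0 - 0"
  proof (intro tendsto_diff tendsto_const)
    show "(\<lambda>n. exp ((1 - b) * ln (real n))) \<longlonglongrightarrow> 0"
      using \<epsilon> unfolding b_def[symmetric] by real_asymp
    show "(\<lambda>n. v / (k n * \<epsilon>\<^sup>2)) \<longlonglongrightarrow> 0"
      using \<epsilon> by (intro real_tendsto_divide_at_top[OF tendsto_const]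
          filterlim_at_top_mult_tendsto_pos[OF tendsto_const _ k_top]) auto
  qed
  hence lim: "(\<lambda>n. 1 - exp ((1 - b) * ln (real n)) - v / (k n * \<epsilon>\<^sup>2)) \<longlonglongrightarrow> 1" by simp
  have lower: "eventually (\<lambda>n. 1 - exp ((1 - b) * ln (real n)) - v / (k n * \<epsilon>\<^sup>2) \<le> max_prob M X (k n) n) sequentially"
    using c(3) eventually_ge_at_top[of 1]
  proof eventually_elim
    case (elim n)
    have "b * ln n \<le> k n * (\<gamma> - \<epsilon>)"
      using mult_right_mono[OF elim(1), of "\<gamma> - \<epsilon>"] \<epsilon> by (simp add: b_def mult_ac)
    hence "n * exp (- (k n * (\<gamma> - \<epsilon>))) \<le> exp (ln n) * exp (- (b * ln n))"
      using elim by (intro mult_mono) auto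
    also have "\<dots> = exp ((1 - b) * ln n)"
      by (simp add: exp_add[symmetric] algebra_simps)
    finally show ?case
      using max_prob_ge[of "k n" n \<epsilon>] k[of n] elim \<epsilon> by simp
  qed
  have upper: "eventually (\<lambda>n. max_prob M X (k n) n \<le> 1) sequentially"
    by (simp add: max_prob_def)
  show ?thesis
    by (rule tendsto_sandwich[OF lower upper lim tendsto_const])
qed

lemma max_prob_tendsto_0:
  fixes k :: "nat \<Rightarrow> nat"
  assumes k: "\<And>n. n \<ge> 1 \<Longrightarrow> k n \<ge> 1"
    and c: "c > 0" "c * \<gamma> < 1" "eventually (\<lambda>n. k n \<le> c * ln n) sequentially"
  shows "(\<lambda>n. max_prob M X (k n) n) \<longlonglongrightarrow> 0"
proof -
  \<comment> \<open>Again half the gap: \<open>c * (\<gamma> + \<epsilon>)\<close> is the midpoint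
    of \<open>c * \<gamma>\<close> and 1, still below 1.\<close>
  define \<epsilon> where "\<epsilon> = (1 / c - \<gamma>) / 2"
  \<comment> \<open>\<open>k n\<close> may stay bounded, where Chebyshev's inequality is useless; \<open>m n \<ge> k n\<close> tends to infinity.\<close>
  define m where "m = (\<lambda>n::nat. nat \<lceil>c * ln n\<rceil>)"
  have \<epsilon>: "\<epsilon> > 0" "c * (\<gamma> + \<epsilon>) < 1"
  proof -
    have "\<gamma> < 1 / c" using c by (simp add: field_simps)
    thus "\<epsilon> > 0" by (simp add: \<epsilon>_def)
    show "c * (\<gamma> + \<epsilon>) < 1" using c by (simp add: \<epsilon>_def field_simps)
  qed
  define b where "b = c * (\<gamma> + \<epsilon>)"
  \<comment> \<open>Pays for the rounding in \<open>m\<close>: \<open>m n\<close> exceeds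
    \<open>c * ln n\<close> by at most 1, which costs at most this constant factor.\<close>
  define C where "C = exp (- (\<gamma> + \<epsilon>))"
  have b: "0 < b" "b < 1" using \<epsilon> c \<gamma>_nonneg by (auto simp: b_def)
  have C: "C > 0" by (simp add: C_def)
  have m: "c * ln n \<le> m n" for n
    by (simp add: m_def) linarith
  have m_top: "filterlim (\<lambda>n. real (m n)) at_top sequentially"
  proof (rule filterlim_at_top_mono)
    show "filterlim (\<lambda>n. c * ln (real n)) at_top sequentially"
      using c(1) by real_asymp
    show "eventually (\<lambda>n. c * ln (real n) \<le> real (m n)) sequentially"
      using m by simp
  qed
  \<comment> \<open>The exponent is minus a quantity of order \<open>n\<close> to the power
    \<open>1 - b\<close>, which diverges because \<open>b < 1\<close>.\<close>
  have "(\<lambda>n. exp (- ((real n - 1) * (C * exp (- (b * ln n))))) + v / (m n * \<epsilon>\<^sup>2)) \<longlonglongrightarrow> 0 + 0"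
  proof (intro tendsto_add)
    show "(\<lambda>n. exp (- ((real n - 1) * (C * exp (- (b * ln n)))))) \<longlonglongrightarrow> 0"
      using b C by real_asymp
    show "(\<lambda>n. v / (m n * \<epsilon>\<^sup>2)) \<longlonglongrightarrow> 0"
      using \<epsilon> by (intro real_tendsto_divide_at_top[OF tendsto_const]
          filterlim_at_top_mult_tendsto_pos[OF tendsto_const _ m_top]) auto
  qed
  hence lim: "(\<lambda>n. exp (- ((real n - 1) * (C * exp (- (b * ln n))))) + v / (m n * \<epsilon>\<^sup>2)) \<longlonglongrightarrow> 0" by simp
  have upper: "eventually (\<lambda>n. max_prob M X (k n) n \<le>
      exp (- ((real n - 1) * (C * exp (- (b * ln n))))) + v / (m n * \<epsilon>\<^sup>2)) sequentially"
    using c(3) eventually_ge_at_top[of 1]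
  proof eventually_elim
    case (elim n)
    have km: "k n \<le> m n" using m[of n] elim by linarith
    have "0 \<le> c * ln n" using elim c by simp
    hence "real (m n) \<le> c * ln n + 1" unfolding m_def by linarith
    hence "m n * (\<gamma> + \<epsilon>) \<le> (c * ln n + 1) * (\<gamma> + \<epsilon>)"
      using \<epsilon> \<gamma>_nonneg by (intro mult_right_mono) auto
    also have "\<dots> = b * ln n + (\<gamma> + \<epsilon>)" by (simp add: b_def algebra_simps)
    finally have "exp (- (b * ln n + (\<gamma> + \<epsilon>))) \<le> exp (- (m n * (\<gamma> + \<epsilon>)))" by simp
    hence "C * exp (- (b * ln n)) \<le> exp (- (m n * (\<gamma> + \<epsilon>)))"
      by (simp add: C_def exp_add[symmetric] algebra_simps)
    hence "exp (- (real (n - 1) * exp (- (m n * (\<gamma> + \<epsilon>))))) \<le> exp (- ((real n - 1) * (C * exp (- (b * ln n)))))"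
      using elim by (simp add: of_nat_diff mult_left_mono)
    thus ?case
      using max_prob_le[of "k n" "m n" n \<epsilon>] k[of n] elim \<epsilon> km by linarith
  qed
  have lower: "eventually (\<lambda>n. 0 \<le> max_prob M X (k n) n) sequentially"
    by (simp add: max_prob_def)
  show ?thesis
    by (rule tendsto_sandwich[OF lower upper tendsto_const lim])
qed

end

section \<open>From distribution functions and extended reals to the two limits\<close>

theorem corollary1:
  fixes M :: "'a measure"
    and X :: "nat \<Rightarrow> nat \<Rightarrow> 'a \<Rightarrow> real"
    and Y :: "'a \<Rightarrow> real"
    and F :: "real \<Rightarrow> real"
    and k :: "nat \<Rightarrow> nat"
  assumes "prob_space M"
    and "prob_space.indep_vars M (\<lambda>_. borel) (\<lambda>(i, j). X i j) ({1..} \<times> {1..})"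
    and "\<And>i j. i \<ge> 1 \<Longrightarrow> j \<ge> 1 \<Longrightarrow> cdf (distr M borel (X i j)) = F"
    and "Y \<in> borel_measurable M"
    and "cdf (distr M borel Y) = F"
    and "\<And>n. n \<ge> 1 \<Longrightarrow> k n \<ge> 1"
  shows "(liminf (\<lambda>n. ereal (real (k n) / ln (real n))) > gamma_inv M Y \<longrightarrow>
            (\<lambda>n. max_prob M X (k n) n) \<longlonglongrightarrow> 1) \<and>
         (limsup (\<lambda>n. ereal (real (k n) / ln (real n))) < gamma_inv M Y \<longrightarrow>
            (\<lambda>n. max_prob M X (k n) n) \<longlonglongrightarrow> 0)"
proof -
  interpret prob_space M by fact
  define D where "D = distr M borel Y"
  have rv: "random_variable borel (X i j)" if "i \<ge> 1" "j \<ge> 1" for i j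
    using assms(2) that by (auto simp: indep_vars_def)
  \<comment> \<open>The distribution function determines the law, so all entries share the law of
    \<open>Y\<close>.\<close>
  have "distr M borel (X i j) = D" if "i \<ge> 1" "j \<ge> 1" for i j
    unfolding D_def using assms(3)[OF that] assms(5) rv[OF that] assms(4)
    by (intro cdf_unique real_distribution_distr) auto
  then interpret iid_array M X D
    by unfold_locales (use assms(2) in auto)
  have surv: "survival M Y x = measure D {x..}" for x
    using assms(4) by (simp add: survival_def D_def measure_distr vimage_def Int_def conj_commute)
  have "gamma_const M Y = expectation (\<lambda>\<omega>. neg_log_survival D (Y \<omega>))"
    by (simp add: gamma_const_def surv neg_log_survival_def)
  also have "\<dots> = \<gamma>"
    using assms(4) unfolding \<gamma>_def by (subst (2) D_def) (simp add: integral_distr)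
  finally have gi: "gamma_inv M Y = inverse (ereal \<gamma>)" by (simp add: gamma_inv_def)
  let ?r = "\<lambda>n. ereal (real (k n) / ln (real n))"
  \<comment> \<open>At \<open>n = 0\<close> and \<open>n = 1\<close> the logarithm is 0 and the
    quotient has the default value 0; clearing the denominator is valid only beyond.\<close>
  have ln_pos: "eventually (\<lambda>n. ln (real n) > 0) sequentially" by real_asymp
  show ?thesis
  proof (intro conjI impI)
    assume "liminf ?r > gamma_inv M Y"
    then obtain c where c: "inverse (ereal \<gamma>) < ereal c" "ereal c < liminf ?r"
      unfolding gi using ereal_dense2 by blast
    \<comment> \<open>If \<open>\<gamma> = 0\<close>, the extended reciprocal is infinite and lies
      below no real \<open>c\<close>.\<close>
    have g: "\<gamma> > 0" using c(1) \<gamma>_nonneg by (cases "\<gamma> = 0") auto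
    hence c': "inverse \<gamma> < c" using c(1) by simp
    have "c > 0" "c * \<gamma> > 1"
      using c' g by (auto simp: field_simps intro: less_trans[OF _ c'])
    moreover have "eventually (\<lambda>n. c * ln n \<le> k n) sequentially"
      using less_LiminfD[OF c(2)] ln_pos by eventually_elim (simp add: field_simps)
    ultimately show "(\<lambda>n. max_prob M X (k n) n) \<longlonglongrightarrow> 1"
      by (intro max_prob_tendsto_1 assms)
  next
    assume "limsup ?r < gamma_inv M Y"
    then obtain c where c: "limsup ?r < ereal c" "ereal c < inverse (ereal \<gamma>)"
      unfolding gi using ereal_dense2 by blast
    have "0 \<le> limsup ?r"
      by (rule le_Limsup) (use ln_pos in \<open>auto elim!: eventually_mono\<close>)
    hence c0: "c > 0" using c(1) by (metis ereal_less(2) le_less_trans)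
    \<comment> \<open>For \<open>\<gamma> = 0\<close> this reads \<open>0 < 1\<close>, so the
      degenerate law is covered for every finite \<open>c\<close>.\<close>
    moreover have "c * \<gamma> < 1"
      using c(2) \<gamma>_nonneg by (cases "\<gamma> = 0") (auto simp: field_simps)
    moreover have "eventually (\<lambda>n. k n \<le> c * ln n) sequentially"
      using Limsup_lessD[OF c(1)] ln_pos by eventually_elim (simp add: field_simps)
    ultimately show "(\<lambda>n. max_prob M X (k n) n) \<longlonglongrightarrow> 0"
      by (intro max_prob_tendsto_0 assms)
  qed
qed

end
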